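(* Let $f:\mathbb{R}^D\to\mathcal{Y}$ be a classifier, where $\mathcal{Y}=\{1,\dots,K\}$ or $\mathcal{Y}=\{-1,1\}$ (labels being exactly representable floating-point numbers), let $\mathbf{x}\in\mathbb{R}^D$ be an instance all of whose coordinates are floating-point numbers, and let $R(f,\mathbf{x})$ be a certification mechanism that is sound when employing real arithmetic, i.e. its exact real value $R=R(f,\mathbf{x})$ satisfies: for all $\mathbf{x}'\in\mathbb{R}^D$, $\|\mathbf{x}'-\mathbf{x}\|\le R$ implies $f(\mathbf{x}')=f(\mathbf{x})$. Suppose that $R(f,\cdot)$ can be computed by a composition of real-valued operators $\psi_1,\dots,\psi_L$, so that $$R(f,\mathbf{x})=(\psi_L\circ\psi_{L-1}\circ\cdots\circ\psi_1)(\mathbf{x},f(\mathbf{x})),$$ and that each $\psi_l$ has a sound floating-point extension $\phi_l$. Define $\underline{R}(f,\mathbf{x})$ as follows: run the composition $\phi_L\circ\cdots\circ\phi_1$ on the coordinate-wise degenerate intervals $[\mathbf{x},\mathbf{x}]$, $[f(\mathbf{x}),f(\mathbf{x})]$ to obtain an interval $[\underline{R},\overline{R}]$ with floating-point endpoints, and return $\underline{R}(f,\mathbf{x})=\underline{R}$. Then the certification mechanism $\underline{R}(f,\mathbf{x})$ is sound with floating-point arithmetic under the strong threat model: for every $\mathbf{x}'\in\mathbb{R}^D$ and every upper bound $\overline{\|\mathbf{x}'-\mathbf{x}\|}$ on the exact real norm $\|\mathbf{x}'-\mathbf{x}\|$, if $\overline{\|\mathbf{x}'-\mathbf{x}\|}\le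 \underline{R}(f,\mathbf{x})$ then $f(\mathbf{x}')=f(\mathbf{x})$.
   Context: $\|\cdot\|$ is the Euclidean ($\ell_2$) norm on $\mathbb{R}^D$. The floating-point numbers form a fixed finite subset $\mathbb{F}\subset\mathbb{R}$ (e.g. the IEEE 754 double-precision numbers); endpoints of floating-point intervals are taken in $\mathbb{F}\cup\{-\infty,+\infty\}$. A floating-point box is a finite product of floating-point intervals; a floating-point constant $c$ is represented by the degenerate interval $[c,c]$, and a floating-point vector by the product of the degenerate intervals of its coordinates. Operators: each $\psi_l$ is a (possibly partially defined) function from $\mathbb{R}^{n_{l-1}}$ to $\mathbb{R}^{n_l}$, with $n_0=D+1$ and $n_L=1$, and the composition is defined at $(\mathbf{x},f(\mathbf{x}))$. Typical components are elementary arithmetic operations (with constants, such as model parameters, built in), square roots, and other standard functions. Sound floating-point extension: a map $\phi$ sending floating-point boxes in $\mathbb{R}^{n}$ to floating-point boxes in $\mathbb{R}^{m}$ is a sound floating-point extension of an operator $\psi$ from $\mathbb{R}^n$ to $\mathbb{R}^m$ if for every floating-point box $B\subseteq\mathbb{R}^n$ and every $\mathbf{v}\in B$ in the domain of $\psi$, one has $\psi(\mathbf{v})\in\phi(B)$, where $\psi(\mathbf{v})$ is computed in exact real arithmetic. Strong threat model: an attack on a computed radius $\tilde R$ for $f$ at $\mathbf{x}$ is a perturbed point $\mathbf{x}'=\mathbf{x}+\boldsymbol{\delta}$ with $f(\mathbf{x}')\ne f(\mathbf{x})$, and it is successful if $\overline{\|\boldsymbol{\delta}\|}\le\tilde R$,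 where $\overline{\|\boldsymbol{\delta}\|}$ is a computed quantity (obtained by rounded interval arithmetic) guaranteed to be greater than or equal to the exact real norm $\|\boldsymbol{\delta}\|$. A computed radius is sound under the strong threat model if there is no successful attack on it. *)

theory Defs
  imports
    "Jordan_Normal_Form.Matrix"
    "HOL-Library.Extended_Real"
    "HOL-Library.Interval"
    "HOL-Analysis.L2_Norm"
begin

definition l2_norm_vec :: "real vec \<Rightarrow> real" where
  "l2_norm_vec v = L2_set (vec_index v) {..<dim_vec v}"

(* An ereal interval carries its endpoints; as a set of numbers it stands for the real
   numbers between them.  A box is the vector of its factors.  Intervals [c, c] with c
   infinite are not excluded; they contain no real number. *)

definition fp_intervals :: "real set \<Rightarrow> ereal interval set" where
  "fp_intervals F =
     {I. lower I \<in> ereal ` F \<union> {-\<infinity>, \<infinity>} \<and> upper I \<in> ereal ` F \<union> {-\<infinity>, \<infinity>}}"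

definition fp_boxes :: "real set \<Rightarrow> nat \<Rightarrow> ereal interval vec set" where
  "fp_boxes F n = {B \<in> carrier_vec n. \<forall>i<n. B $ i \<in> fp_intervals F}"

definition box_points :: "ereal interval vec \<Rightarrow> real vec set" where
  "box_points B = {v \<in> carrier_vec (dim_vec B). \<forall>i<dim_vec B. ereal (v $ i) \<in> set_of (B $ i)}"

definition degenerate_box :: "real vec \<Rightarrow> ereal interval vec" where
  "degenerate_box v = map_vec (\<lambda>c. interval_of (ereal c)) v"

definition partial_operator :: "nat \<Rightarrow> nat \<Rightarrow> (real vec \<rightharpoonup> real vec) \<Rightarrow> bool" where
  "partial_operator n m \<psi> \<longleftrightarrow> dom \<psi> \<subseteq> carrier_vec n \<and> ran \<psi> \<subseteq> carrier_vec m"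

definition sound_fp_extension ::
  "real set \<Rightarrow> nat \<Rightarrow> nat \<Rightarrow> (real vec \<rightharpoonup> real vec) \<Rightarrow>
   (ereal interval vec \<Rightarrow> ereal interval vec) \<Rightarrow> bool" where
  "sound_fp_extension F n m \<psi> \<phi> \<longleftrightarrow>
     (\<forall>B \<in> fp_boxes F n. \<phi> B \<in> fp_boxes F m) \<and>
     (\<forall>B \<in> fp_boxes F n. \<forall>v \<in> box_points B \<inter> dom \<psi>. the (\<psi> v) \<in> box_points (\<phi> B))"

(* psi L o ... o psi 1 and phi L o ... o phi 1 *)

definition compose_partial :: "(nat \<Rightarrow> 'a \<rightharpoonup> 'a) \<Rightarrow> nat \<Rightarrow> 'a \<rightharpoonup> 'a" where
  "compose_partial \<psi> L = fold (\<lambda>l g. \<psi> l \<circ>\<^sub>m g) [1..<Suc L] Some"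

definition compose_total :: "(nat \<Rightarrow> 'a \<Rightarrow> 'a) \<Rightarrow> nat \<Rightarrow> 'a \<Rightarrow> 'a" where
  "compose_total \<phi> L = fold (\<lambda>l g. \<phi> l \<circ> g) [1..<Suc L] id"

(* The pair (x, f x) as a vector with one more coordinate. *)
definition instance_with_label :: "(real vec \<Rightarrow> int) \<Rightarrow> real vec \<Rightarrow> real vec" where
  "instance_with_label f x = x @\<^sub>v vec_of_list [real_of_int (f x)]"

definition fp_radius ::
  "(nat \<Rightarrow> ereal interval vec \<Rightarrow> ereal interval vec) \<Rightarrow> nat \<Rightarrow>
   (real vec \<Rightarrow> int) \<Rightarrow> real vec \<Rightarrow> ereal" where
  "fp_radius \<phi> L f x =
     lower (compose_total \<phi> L (degenerate_box (instance_with_label f x)) $ 0)"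

definition sound_real_radius ::
  "nat \<Rightarrow> (real vec \<Rightarrow> int) \<Rightarrow> real vec \<Rightarrow> real \<Rightarrow> bool" where
  "sound_real_radius D f x r \<longleftrightarrow>
     (\<forall>x' \<in> carrier_vec D. l2_norm_vec (x' - x) \<le> r \<longrightarrow> f x' = f x)"

(* u is the computed upper bound on the norm of the perturbation; interval arithmetic may
   return plus infinity, so u is extended real. *)

definition successful_strong_attack ::
  "nat \<Rightarrow> (real vec \<Rightarrow> int) \<Rightarrow> real vec \<Rightarrow> ereal \<Rightarrow> real vec \<Rightarrow> ereal \<Rightarrow> bool" where
  "successful_strong_attack D f x r \<delta> u \<longleftrightarrow>
     \<delta> \<in> carrier_vec D \<and> f (x + \<delta>) \<noteq> f x \<and> ereal (l2_norm_vec \<delta>) \<le> u \<and> u \<le> r"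

definition sound_strong_threat_model ::
  "nat \<Rightarrow> (real vec \<Rightarrow> int) \<Rightarrow> real vec \<Rightarrow> ereal \<Rightarrow> bool" where
  "sound_strong_threat_model D f x r \<longleftrightarrow> (\<nexists>\<delta> u. successful_strong_attack D f x r \<delta> u)"

lemma sound_strong_threat_model_iff:
  assumes x: "x \<in> carrier_vec D"
  shows "sound_strong_threat_model D f x r \<longleftrightarrow>
    (\<forall>x' \<in> carrier_vec D. \<forall>u. ereal (l2_norm_vec (x' - x)) \<le> u \<longrightarrow> u \<le> r \<longrightarrow> f x' = f x)"
proof -
  have 1: "x + \<delta> - x = \<delta>" if "\<delta> \<in> carrier_vec D" for \<delta>
    using x that by (intro eq_vecI) auto
  have 2: "x + (x' - x) = x'" if "x' \<in> carrier_vec D" for x'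
    using x that by (intro eq_vecI) auto
  show ?thesis
    unfolding sound_strong_threat_model_def successful_strong_attack_def
    using x by (metis 1 2 add_carrier_vec minus_carrier_vec)
qed

end

theory Submission
  imports Defs
begin

text \<open>Soundness of floating-point extensions is closed under composition, so the interval computed
  from \<open>[x, x]\<close> and \<open>[f x, f x]\<close> contains the exact radius \<open>R\<close> and its lower endpoint is at most
  \<open>R\<close>.  A perturbation whose norm bound is at most that endpoint therefore has exact norm at most
  \<open>R\<close>, where soundness in real arithmetic applies.\<close>

text \<open>Since \<open>\<phi> B\<close> is again a floating-point box, soundness of
  \<open>\<phi>'\<close> applies to it. Where the composite is defined, the intermediate value
  exists and lies in \<open>dom \<psi>'\<close>.\<close>

lemma sound_fp_extension_comp:
  assumes "sound_fp_extension F n m \<psi> \<phi>" and "sound_fp_extension F m k \<psi>' \<phi>'"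
  shows "sound_fp_extension F n k (\<psi>' \<circ>\<^sub>m \<psi>) (\<phi>' \<circ> \<phi>)"
  unfolding sound_fp_extension_def
proof (intro conjI ballI)
  fix B assume B: "B \<in> fp_boxes F n"
  then have B': "\<phi> B \<in> fp_boxes F m"
    using assms(1) by (simp add: sound_fp_extension_def)
  then show "(\<phi>' \<circ> \<phi>) B \<in> fp_boxes F k"
    using assms(2) by (simp add: sound_fp_extension_def)
  fix v assume v: "v \<in> box_points B \<inter> dom (\<psi>' \<circ>\<^sub>m \<psi>)"
  then obtain w u where w: "\<psi> v = Some w" and u: "\<psi>' w = Some u"
    by (auto simp: map_comp_Some_iff)
  have "v \<in> box_points B \<inter> dom \<psi>"
    using v w by auto
  then have "the (\<psi> v) \<in> box_points (\<phi> B)"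
    using assms(1) B unfolding sound_fp_extension_def by blast
  then have "w \<in> box_points (\<phi> B) \<inter> dom \<psi>'"
    using w u by auto
  then have "the (\<psi>' w) \<in> box_points (\<phi>' (\<phi> B))"
    using assms(2) B' unfolding sound_fp_extension_def by blast
  then show "the ((\<psi>' \<circ>\<^sub>m \<psi>) v) \<in> box_points ((\<phi>' \<circ> \<phi>) B)"
    using w by simp
qed

text \<open>Induction on \<open>L\<close> that splits off the outermost operator, which the folds
  over \<open>[1..<Suc L]\<close> compose on last.\<close>

lemma sound_fp_extension_compose:
  assumes "\<forall>l\<in>{1..L}. sound_fp_extension F (n (l - 1)) (n l) (\<psi> l) (\<phi> l)"
  shows "sound_fp_extension F (n 0) (n L) (compose_partial \<psi> L) (compose_total \<phi> L)"
  using assms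
proof (induction L)
  case 0
  \<comment> \<open>With no operators the folds are \<open>Some\<close> and \<open>id\<close>, so
    points and boxes are returned unchanged.\<close>
  then show ?case
    by (simp add: compose_partial_def compose_total_def sound_fp_extension_def)
next
  case (Suc L)
  have "sound_fp_extension F (n 0) (n L) (compose_partial \<psi> L) (compose_total \<phi> L)"
    using Suc by simp
  moreover have "sound_fp_extension F (n L) (n (Suc L)) (\<psi> (Suc L)) (\<phi> (Suc L))"
    using Suc.prems by force
  ultimately have "sound_fp_extension F (n 0) (n (Suc L))
      (\<psi> (Suc L) \<circ>\<^sub>m compose_partial \<psi> L) (\<phi> (Suc L) \<circ> compose_total \<phi> L)"
    by (rule sound_fp_extension_comp)
  moreover have "compose_partial \<psi> (Suc L) = \<psi> (Suc L) \<circ>\<^sub>m compose_partial \<psi> L"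
    and "compose_total \<phi> (Suc L) = \<phi> (Suc L) \<circ> compose_total \<phi> L"
    by (simp_all add: compose_partial_def compose_total_def)
  ultimately show ?case
    by (simp only:)
qed

lemma degenerate_box_in_fp_boxes:
  assumes "v \<in> carrier_vec n" and "\<forall>i<n. v $ i \<in> F"
  shows "degenerate_box v \<in> fp_boxes F n"
  using assms by (auto simp: degenerate_box_def fp_boxes_def fp_intervals_def)

lemma in_box_points_degenerate_box: "v \<in> box_points (degenerate_box v)"
  by (auto simp: degenerate_box_def box_points_def)

theorem theorem1:
  fixes F :: "real set"
    and D L :: nat
    and Y :: "int set"
    and f :: "real vec \<Rightarrow> int"
    and x :: "real vec"
    and R :: "(real vec \<Rightarrow> int) \<Rightarrow> real vec \<Rightarrow> real"
    and n :: "nat \<Rightarrow> nat"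
    and \<psi> :: "nat \<Rightarrow> real vec \<rightharpoonup> real vec"
    and \<phi> :: "nat \<Rightarrow> ereal interval vec \<Rightarrow> ereal interval vec"
  assumes F: "finite F"
    and Y: "(\<exists>K::nat. Y = {1..int K}) \<or> Y = {-1, 1}"
    and labels: "real_of_int ` Y \<subseteq> F"
    and f: "f \<in> carrier_vec D \<rightarrow> Y"
    and x: "x \<in> carrier_vec D"
    and x_fp: "\<forall>i<D. x $ i \<in> F"
    and R_sound: "sound_real_radius D f x (R f x)"
    and L: "1 \<le> L"
    and n_first: "n 0 = D + 1"
    and n_last: "n L = 1"
    and \<psi>: "\<forall>l\<in>{1..L}. partial_operator (n (l - 1)) (n l) (\<psi> l)"
    and R_comp: "compose_partial \<psi> L (instance_with_label f x) = Some (vec_of_list [R f x])"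
    and \<phi>: "\<forall>l\<in>{1..L}. sound_fp_extension F (n (l - 1)) (n l) (\<psi> l) (\<phi> l)"
  shows "sound_strong_threat_model D f x (fp_radius \<phi> L f x)"
proof -
  let ?v = "instance_with_label f x"
  let ?B = "degenerate_box ?v"
  let ?C = "compose_total \<phi> L ?B"
  have ext: "sound_fp_extension F (D + 1) 1 (compose_partial \<psi> L) (compose_total \<phi> L)"
    using sound_fp_extension_compose[OF \<phi>] n_first n_last by simp
  \<comment> \<open>The label is a coordinate of the input, so its degenerate interval must have
    endpoints in \<open>F\<close> as well.\<close>
  have label: "real_of_int (f x) \<in> F"
    using f x labels by blast
  have "?v \<in> carrier_vec (D + 1)"
    unfolding instance_with_label_def using x by (intro append_carrier_vec) simp_all
  \<comment> \<open>Indices below \<open>D\<close> give the coordinates of \<open>x\<close>; index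
    \<open>D\<close> gives the label.\<close>
  moreover have "\<forall>i<D + 1. ?v $ i \<in> F"
    using x x_fp label by (auto simp: instance_with_label_def less_Suc_eq)
  ultimately have B: "?B \<in> fp_boxes F (D + 1)"
    by (rule degenerate_box_in_fp_boxes)
  have C: "?C \<in> fp_boxes F 1"
    using ext B unfolding sound_fp_extension_def by blast
  have "?v \<in> box_points ?B \<inter> dom (compose_partial \<psi> L)"
    using R_comp in_box_points_degenerate_box by blast
  then have "the (compose_partial \<psi> L ?v) \<in> box_points ?C"
    using ext B unfolding sound_fp_extension_def by blast
  \<comment> \<open>Membership in \<open>fp_boxes F 1\<close> fixes the dimension of
    \<open>?C\<close> as 1, so index \<open>0\<close> is in range and selects its only
    factor.\<close>
  then have "ereal (R f x) \<in> set_of (?C $ 0)"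
    using R_comp C by (auto simp: box_points_def fp_boxes_def)
  then have le: "fp_radius \<phi> L f x \<le> ereal (R f x)"
    by (simp add: fp_radius_def set_of_eq)
  show ?thesis
    unfolding sound_strong_threat_model_iff[OF x]
  proof (intro ballI allI impI)
    fix x' u
    assume x': "x' \<in> carrier_vec D"
      and "ereal (l2_norm_vec (x' - x)) \<le> u" and "u \<le> fp_radius \<phi> L f x"
    \<comment> \<open>The chain through \<open>u\<close> and the computed radius runs in the
      extended reals, where either could a priori be infinite; both ends are real, so it yields a
      real inequality.\<close>
    then have "ereal (l2_norm_vec (x' - x)) \<le> ereal (R f x)"
      using le by (meson order_trans)
    then show "f x' = f x"
      using R_sound x' by (simp add: sound_real_radius_def)
  qed
qed

end
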